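(* Let $X_t$ be a BN random process, with $X_t\sim\text{BN}(\mu,\sigma_t,\alpha)$, whose mean $\mu$ is independent of time. Then $X_t$ is mean ergodic whenever $$\lim_{T\to\infty}\frac{1}{2T}\int_{-T}^{T}\sigma_t\,\mathrm{d}t=0.$$ For example, one can take $\sigma_t=\exp(-t^2)$.
   Context: For $\mu\in\mathbb{R}$, $\sigma>0$, $\alpha\in\mathbb{R}$, BN$(\mu,\sigma,\alpha)$ is the distribution on $\mathbb{R}$ with PDF $$f(x;\mu,\sigma,\alpha)=\frac{1}{\sqrt{2\pi\sigma^2}}\exp\left[-\frac12\left(\frac{x-\mu}{\sigma}\right)^2-\frac{\alpha^2}{2}\right]\cosh\left[\alpha\left(\frac{x-\mu}{\sigma}\right)\right].$$ A process $X_t$ ($t\in\mathbb{R}$) is a BN random process if $X_t\sim\text{BN}(\boldsymbol{\theta}_t)$ for every $t$, where $\boldsymbol{\theta}_t=(\mu_t,\sigma_t,\alpha)$, $\mu_t\in\mathbb{R}$, $\sigma_t>0$, $\alpha\in\mathbb{R}$ ($\alpha$ does not depend on $t$); its mean is $\mathbb{E}(X_t)=\mu_t$. The temporal mean of a process $X_t$ is $\langle m_X\rangle_T=\frac{1}{2T}\int_{-T}^{T}X_t\,\mathrm{d}t$, $T>0$ (the process is understood to be such that this integral makes sense as a random variable). A process $X_t$ with mean $\mu$ independent of time is mean ergodic if $\lim_{T\to\infty}\mathrm{Var}(\langle m_X\rangle_T)=\lim_{T\to\infty}\mathbb{E}(\langle m_X\rangle_T-\mu)^2=0$.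
   Formalization: The process is assumed jointly measurable in time and outcome; if one only asks that the temporal mean be a well-defined random variable, the claim can fail, since paths may be altered on time-dependent null sets without changing the laws of the X_t. *)

theory Defs
  imports "HOL-Probability.Probability"
begin

definition bn_density :: "real \<Rightarrow> real \<Rightarrow> real \<Rightarrow> real \<Rightarrow> real" where
  "bn_density \<mu> \<sigma> \<alpha> x =
     1 / sqrt (2 * pi * \<sigma>\<^sup>2) * exp (- (1 / 2) * ((x - \<mu>) / \<sigma>)\<^sup>2 - \<alpha>\<^sup>2 / 2)
       * cosh (\<alpha> * ((x - \<mu>) / \<sigma>))"

definition bn_process ::
  "'a measure \<Rightarrow> (real \<Rightarrow> 'a \<Rightarrow> real) \<Rightarrow> (real \<Rightarrow> real) \<Rightarrow> (real \<Rightarrow> real) \<Rightarrow> real \<Rightarrow> bool" where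
  "bn_process M X \<mu> \<sigma> \<alpha> \<longleftrightarrow>
     prob_space M \<and>
     (\<forall>t. \<sigma> t > 0 \<and> distributed M lborel (X t) (\<lambda>x. ennreal (bn_density (\<mu> t) (\<sigma> t) \<alpha> x)))"

text \<open>
  Joint measurability in time and outcome, the usual standing assumption under which
  time integrals of sample paths are random variables. It is not implied by
  measurability of the individual \<open>X t\<close>.
\<close>

definition measurable_process :: "'a measure \<Rightarrow> (real \<Rightarrow> 'a \<Rightarrow> real) \<Rightarrow> bool" where
  "measurable_process M X \<longleftrightarrow> (\<lambda>(t, \<omega>). X t \<omega>) \<in> borel_measurable (borel \<Otimes>\<^sub>M M)"

definition temporal_mean :: "(real \<Rightarrow> 'a \<Rightarrow> real) \<Rightarrow> real \<Rightarrow> 'a \<Rightarrow> real" where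
  "temporal_mean X T \<omega> = 1 / (2 * T) * (LBINT t:{-T..T}. X t \<omega>)"

text \<open>
  Lebesgue integrals of non-integrable functions are 0 by convention, so the existence of
  all the integrals involved (the means, the path integrals for almost every outcome, and
  the second moments of the temporal means) is required explicitly; otherwise the limits
  could hold for spurious reasons.
\<close>

definition mean_ergodic :: "'a measure \<Rightarrow> (real \<Rightarrow> 'a \<Rightarrow> real) \<Rightarrow> real \<Rightarrow> bool" where
  "mean_ergodic M X \<mu> \<longleftrightarrow>
     (\<forall>t. integrable M (X t) \<and> prob_space.expectation M (X t) = \<mu>) \<and>
     (\<forall>T>0. (AE \<omega> in M. set_integrable lborel {-T..T} (\<lambda>t. X t \<omega>)) \<and>
            temporal_mean X T \<in> borel_measurable M \<and>
            integrable M (\<lambda>\<omega>. (temporal_mean X T \<omega>)\<^sup>2)) \<and>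
     ((\<lambda>T. prob_space.variance M (temporal_mean X T)) \<longlongrightarrow> 0) at_top \<and>
     ((\<lambda>T. prob_space.expectation M (\<lambda>\<omega>. (temporal_mean X T \<omega> - \<mu>)\<^sup>2)) \<longlongrightarrow> 0) at_top"

text \<open>
  Local integrability makes the integrals in the limit meaningful: a nonnegative function
  that is not integrable on some symmetric interval would again get integral 0.
\<close>

definition vanishing_time_average :: "(real \<Rightarrow> real) \<Rightarrow> bool" where
  "vanishing_time_average \<sigma> \<longleftrightarrow>
     (\<forall>T>0. set_integrable lborel {-T..T} \<sigma>) \<and>
     ((\<lambda>T. 1 / (2 * T) * (LBINT t:{-T..T}. \<sigma> t)) \<longlongrightarrow> 0) at_top"

end

theory Submission imports Defs begin

text \<open>
  BN\<open>(\<mu>, \<sigma>, \<alpha>)\<close> is the equal mixture of the normal laws with means \<open>\<mu> \<plusminus> \<alpha> \<sigma>\<close> and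
  standard deviation \<open>\<sigma>\<close>, so its variance is \<open>(1 + \<alpha>\<^sup>2) \<sigma>\<^sup>2\<close>. Writing
  \<open>Y\<^sub>t = X\<^sub>t - \<mu>\<close>, the Cauchy-Schwarz inequality with weight \<open>\<sigma>\<close> gives
  \<open>(\<integral>\<bar>Y\<^sub>t\<bar> dt)\<^sup>2 \<le> \<integral>\<sigma>\<^sub>t dt \<cdot> \<integral>Y\<^sub>t\<^sup>2 / \<sigma>\<^sub>t dt\<close> on every path. Taking expectations and
  exchanging the integrals bounds the mean square error of the temporal mean by
  \<open>(1 + \<alpha>\<^sup>2)\<close> times the square of the time average of \<open>\<sigma>\<close>; no assumption on the
  dependence between different times is needed.
\<close>

section \<open>Moments of the BN law\<close>

text \<open>With \<open>z = (x - \<mu>) / \<sigma>\<close>, expanding -(z - \<alpha>)^2 / 2 and -(z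
  + \<alpha>)^2 / 2 leaves a common Gaussian factor times the two exponentials that make up
  cosh.\<close>

lemma bn_density_eq_mixture:
  assumes "0 < \<sigma>"
  shows "bn_density \<mu> \<sigma> \<alpha> x =
    (normal_density (\<mu> + \<alpha> * \<sigma>) \<sigma> x + normal_density (\<mu> - \<alpha> * \<sigma>) \<sigma> x) / 2"
proof -
  define z where "z = (x - \<mu>) / \<sigma>"
  have 1: "- (x - (\<mu> + \<alpha> * \<sigma>))\<^sup>2 / (2 * \<sigma>\<^sup>2) = (- (1/2) * z\<^sup>2 - \<alpha>\<^sup>2 / 2) + \<alpha> * z"
    and 2: "- (x - (\<mu> - \<alpha> * \<sigma>))\<^sup>2 / (2 * \<sigma>\<^sup>2) = (- (1/2) * z\<^sup>2 - \<alpha>\<^sup>2 / 2) + - (\<alpha> * z)"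
    using assms unfolding z_def by (simp_all add: field_simps power2_eq_square)
  show ?thesis
    unfolding bn_density_def normal_density_def 1 2 exp_add z_def[symmetric] cosh_def
    by (simp add: algebra_simps add_divide_distrib)
qed

lemma bn_density_nonneg: "0 < \<sigma> \<Longrightarrow> 0 \<le> bn_density \<mu> \<sigma> \<alpha> x"
  by (simp add: bn_density_eq_mixture)

text \<open>Integration is linear in the density, so moments of the mixture reduce to those of its
  two normal components.\<close>

lemma has_bochner_integral_bn_density:
  assumes "0 < \<sigma>"
    and "has_bochner_integral lborel (\<lambda>x. normal_density (\<mu> + \<alpha> * \<sigma>) \<sigma> x * g x) a"
    and "has_bochner_integral lborel (\<lambda>x. normal_density (\<mu> - \<alpha> * \<sigma>) \<sigma> x * g x) b"
  shows "has_bochner_integral lborel (\<lambda>x. bn_density \<mu> \<sigma> \<alpha> x * g x) ((a + b) / 2)"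
  using has_bochner_integral_mult_left[of "1/2", OF has_bochner_integral_add[OF assms(2,3)]]
  by (simp add: bn_density_eq_mixture[OF assms(1)] field_simps)

lemma bn_mean:
  assumes "0 < \<sigma>"
  shows "has_bochner_integral lborel (\<lambda>x. bn_density \<mu> \<sigma> \<alpha> x * x) \<mu>"
  using has_bochner_integral_bn_density[OF assms normal_moment_nz_1 normal_moment_nz_1, of \<mu> \<alpha>] assms
  by simp

lemma normal_second_moment_about:
  assumes "0 < \<sigma>"
  shows "has_bochner_integral lborel (\<lambda>x. normal_density m \<sigma> x * (x - c)\<^sup>2) (\<sigma>\<^sup>2 + (m - c)\<^sup>2)"
proof -
  \<comment> \<open>Expand the square about m, with x - c = (x - m) + (m - c). The exponents are
    spelled \<open>2 * k\<close> and \<open>2 * k + 1\<close> to match the even and odd central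
    moments; the odd one contributes 0.\<close>
  have "has_bochner_integral lborel
     (\<lambda>x. normal_density m \<sigma> x * (x - m) ^ (2 * 1) + normal_density m \<sigma> x * (x - m) ^ (2 * 0 + 1) * (2 * (m - c))
        + normal_density m \<sigma> x * (x - m) ^ (2 * 0) * (m - c)\<^sup>2)
     (fact (2 * 1) / ((2 / \<sigma>\<^sup>2) ^ 1 * fact 1) + 0 * (2 * (m - c))
        + fact (2 * 0) / ((2 / \<sigma>\<^sup>2) ^ 0 * fact 0) * (m - c)\<^sup>2)"
    by (intro has_bochner_integral_add has_bochner_integral_mult_left
        normal_moment_even normal_moment_odd assms)
  then show ?thesis
    by (simp add: power2_eq_square algebra_simps fact_numeral)
qed

text \<open>Both component centres lie at distance \<bar>\<alpha>\<bar> \<sigma> from \<mu>, so each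
  component contributes the same \<sigma>^2 + \<alpha>^2 \<sigma>^2.\<close>

lemma bn_variance:
  assumes "0 < \<sigma>"
  shows "has_bochner_integral lborel (\<lambda>x. bn_density \<mu> \<sigma> \<alpha> x * (x - \<mu>)\<^sup>2) ((1 + \<alpha>\<^sup>2) * \<sigma>\<^sup>2)"
  using has_bochner_integral_bn_density[OF assms
      normal_second_moment_about[OF assms, of "\<mu> + \<alpha> * \<sigma>" \<mu>]
      normal_second_moment_about[OF assms, of "\<mu> - \<alpha> * \<sigma>" \<mu>]]
  by (simp add: algebra_simps power_mult_distrib add_divide_distrib)

text \<open>Moments of the density transfer to \<open>X t\<close> through its law. The second moment
  is stated as a nonnegative extended integral, ready for the exchange of time and outcome.\<close>

lemma
  assumes "bn_process M X \<mu> \<sigma> \<alpha>"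
  shows bn_process_integrable: "integrable M (X t)"
    and bn_process_expectation: "integral\<^sup>L M (X t) = \<mu> t"
    and bn_process_second_moment:
      "(\<integral>\<^sup>+\<omega>. ennreal ((X t \<omega> - \<mu> t)\<^sup>2) \<partial>M) = ennreal ((1 + \<alpha>\<^sup>2) * (\<sigma> t)\<^sup>2)"
proof -
  have pos: "0 < \<sigma> t" and
    D: "distributed M lborel (X t) (\<lambda>x. ennreal (bn_density (\<mu> t) (\<sigma> t) \<alpha> x))"
    using assms by (auto simp: bn_process_def)
  note int = distributed_integrable[OF D] and eq = distributed_integral[OF D]
  note nonneg = bn_density_nonneg[OF pos]
  note mean = bn_mean[OF pos, of "\<mu> t" \<alpha>] and var = bn_variance[OF pos, of "\<mu> t" \<alpha>]
  show "integrable M (X t)"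
    using int[of "\<lambda>x. x"] integrable.intros[OF mean] nonneg by simp
  show "integral\<^sup>L M (X t) = \<mu> t"
    using eq[of "\<lambda>x. x"] has_bochner_integral_integral_eq[OF mean] nonneg by simp
  have "integrable M (\<lambda>\<omega>. (X t \<omega> - \<mu> t)\<^sup>2)"
    using int[of "\<lambda>x. (x - \<mu> t)\<^sup>2"] integrable.intros[OF var] nonneg by simp
  moreover have "integral\<^sup>L M (\<lambda>\<omega>. (X t \<omega> - \<mu> t)\<^sup>2) = (1 + \<alpha>\<^sup>2) * (\<sigma> t)\<^sup>2"
    using eq[of "\<lambda>x. (x - \<mu> t)\<^sup>2"] has_bochner_integral_integral_eq[OF var] nonneg by simp
  ultimately show "(\<integral>\<^sup>+\<omega>. ennreal ((X t \<omega> - \<mu> t)\<^sup>2) \<partial>M) = ennreal ((1 + \<alpha>\<^sup>2) * (\<sigma> t)\<^sup>2)"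
    by (simp add: nn_integral_eq_integral)
qed

section \<open>Weighted Cauchy-Schwarz bound\<close>

text \<open>The weight may vanish because it will be \<sigma> cut off to an interval;
  \<open>y_0\<close> keeps the quotient of y^2 by s harmless there. Extended integrals allow
  Cauchy-Schwarz and Tonelli before anything is known to be finite.\<close>

lemma (in pair_sigma_finite) nn_integral_square_integral_le:
  fixes y :: "'a \<Rightarrow> 'b \<Rightarrow> real" and s :: "'a \<Rightarrow> real"
  assumes y [measurable]: "case_prod y \<in> borel_measurable (M1 \<Otimes>\<^sub>M M2)"
    and s [measurable]: "s \<in> borel_measurable M1"
    and s_nonneg: "\<And>t. 0 \<le> s t"
    and y_0: "\<And>t \<omega>. s t = 0 \<Longrightarrow> y t \<omega> = 0"
    and "0 \<le> c"
    and second: "\<And>t. (\<integral>\<^sup>+\<omega>. ennreal ((y t \<omega>)\<^sup>2) \<partial>M2) \<le> ennreal (c * (s t)\<^sup>2)"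
  shows "(\<integral>\<^sup>+\<omega>. (\<integral>\<^sup>+t. ennreal \<bar>y t \<omega>\<bar> \<partial>M1)\<^sup>2 \<partial>M2) \<le> ennreal c * (\<integral>\<^sup>+t. ennreal (s t) \<partial>M1)\<^sup>2"
proof -
  let ?S = "\<integral>\<^sup>+t. ennreal (s t) \<partial>M1"
  have path: "(\<integral>\<^sup>+t. ennreal \<bar>y t \<omega>\<bar> \<partial>M1)\<^sup>2 \<le> ?S * (\<integral>\<^sup>+t. ennreal ((y t \<omega>)\<^sup>2 / s t) \<partial>M1)"
    if [measurable]: "\<omega> \<in> space M2" for \<omega>
  proof -
    have [measurable]: "(\<lambda>t. y t \<omega>) \<in> borel_measurable M1"
      using measurable_compose[OF measurable_Pair2'[OF that] y] by simp
    \<comment> \<open>The two factors for Cauchy-Schwarz. Where s vanishes, y does too, and both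
      sides are 0.\<close>
    have "(\<integral>\<^sup>+t. ennreal \<bar>y t \<omega>\<bar> \<partial>M1) = (\<integral>\<^sup>+t. ennreal (sqrt (s t)) * ennreal (\<bar>y t \<omega>\<bar> / sqrt (s t)) \<partial>M1)"
      using s_nonneg y_0 by (intro nn_integral_cong) (auto simp: ennreal_mult'[symmetric])
    also have "(\<dots>)\<^sup>2 \<le> (\<integral>\<^sup>+t. (ennreal (sqrt (s t)))\<^sup>2 \<partial>M1) * (\<integral>\<^sup>+t. (ennreal (\<bar>y t \<omega>\<bar> / sqrt (s t)))\<^sup>2 \<partial>M1)"
      by (rule Cauchy_Schwarz_nn_integral) auto
    also have "\<dots> = ?S * (\<integral>\<^sup>+t. ennreal ((y t \<omega>)\<^sup>2 / s t) \<partial>M1)"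
      using s_nonneg by (simp add: ennreal_power power_divide)
    finally show ?thesis .
  qed
  have second': "(\<integral>\<^sup>+\<omega>. ennreal ((y t \<omega>)\<^sup>2 / s t) \<partial>M2) \<le> ennreal c * ennreal (s t)"
    if [measurable]: "t \<in> space M1" for t
  \<comment> \<open>At a zero of s the integrand is 0 / 0 = 0. Elsewhere the weight cancels one of
    the two factors s in the second moment, so the bound is linear in s.\<close>
  proof (cases "s t = 0")
    case False
    then have pos: "0 < s t" using s_nonneg[of t] by simp
    have [measurable]: "y t \<in> borel_measurable M2"
      using measurable_compose[OF measurable_Pair1'[OF that] y] by simp
    have "(\<integral>\<^sup>+\<omega>. ennreal ((y t \<omega>)\<^sup>2 / s t) \<partial>M2) = (\<integral>\<^sup>+\<omega>. ennreal (1 / s t) * ennreal ((y t \<omega>)\<^sup>2) \<partial>M2)"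
      using pos by (simp add: ennreal_mult'[symmetric])
    also have "\<dots> = ennreal (1 / s t) * (\<integral>\<^sup>+\<omega>. ennreal ((y t \<omega>)\<^sup>2) \<partial>M2)"
      by (rule nn_integral_cmult) auto
    also have "\<dots> \<le> ennreal (1 / s t) * ennreal (c * (s t)\<^sup>2)"
      by (intro mult_left_mono second) auto
    also have "\<dots> = ennreal c * ennreal (s t)"
      using pos \<open>0 \<le> c\<close> by (simp add: ennreal_mult'[symmetric] power2_eq_square)
    finally show ?thesis .
  qed (simp add: y_0)
  have "(\<integral>\<^sup>+\<omega>. (\<integral>\<^sup>+t. ennreal \<bar>y t \<omega>\<bar> \<partial>M1)\<^sup>2 \<partial>M2)
      \<le> (\<integral>\<^sup>+\<omega>. ?S * (\<integral>\<^sup>+t. ennreal ((y t \<omega>)\<^sup>2 / s t) \<partial>M1) \<partial>M2)"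
    by (intro nn_integral_mono path)
  also have "\<dots> = ?S * (\<integral>\<^sup>+\<omega>. (\<integral>\<^sup>+t. ennreal ((y t \<omega>)\<^sup>2 / s t) \<partial>M1) \<partial>M2)"
    by (rule nn_integral_cmult) (rule M1.borel_measurable_nn_integral, measurable)
  also have "\<dots> = ?S * (\<integral>\<^sup>+t. (\<integral>\<^sup>+\<omega>. ennreal ((y t \<omega>)\<^sup>2 / s t) \<partial>M2) \<partial>M1)"
    by (subst Fubini') auto
  also have "\<dots> \<le> ?S * (\<integral>\<^sup>+t. ennreal c * ennreal (s t) \<partial>M1)"
    by (intro mult_left_mono nn_integral_mono second') auto
  also have "\<dots> = ennreal c * ?S\<^sup>2"
    by (simp add: nn_integral_cmult power2_eq_square ac_simps)
  finally show ?thesis .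
qed

section \<open>Path integrals and the mean square error\<close>

lemma measurable_process_lborel:
  "measurable_process M X \<longleftrightarrow> case_prod X \<in> borel_measurable (lborel \<Otimes>\<^sub>M M)"
  unfolding measurable_process_def
  by (intro arg_cong2[where f="(\<in>)"] measurable_cong_sets sets_pair_measure_cong) auto

lemma borel_measurable_temporal_mean:
  assumes "measurable_process M X"
  shows "temporal_mean X T \<in> borel_measurable M"
proof -
  have [measurable]: "case_prod X \<in> borel_measurable (lborel \<Otimes>\<^sub>M M)"
    using assms by (simp add: measurable_process_lborel)
  have "(\<lambda>\<omega>. LBINT t. indicator {-T..T} t *\<^sub>R X t \<omega>) \<in> borel_measurable M"
    by measurable
  then show ?thesis
    by (simp add: temporal_mean_def[abs_def] set_lebesgue_integral_def)
qed

text \<open>Both claims come from one estimate on \<open>D\<close>, the path integral of the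
  absolute deviation: its finite second moment makes almost every path integrable, and
  \<open>D\<close> dominates the error up to the factor 1 / (2 T).\<close>

lemma
  fixes X :: "real \<Rightarrow> 'a \<Rightarrow> real"
  assumes "prob_space M" "measurable_process M X" "0 < T" "0 \<le> c"
    and pos: "\<And>t. 0 < \<sigma> t"
    and \<sigma>: "set_integrable lborel {-T..T} \<sigma>"
    and second: "\<And>t. (\<integral>\<^sup>+\<omega>. ennreal ((X t \<omega> - \<mu>)\<^sup>2) \<partial>M) \<le> ennreal (c * (\<sigma> t)\<^sup>2)"
  shows AE_set_integrable_path: "AE \<omega> in M. set_integrable lborel {-T..T} (\<lambda>t. X t \<omega>)"
    and temporal_mean_square_error_le:
      "(\<integral>\<^sup>+\<omega>. ennreal ((temporal_mean X T \<omega> - \<mu>)\<^sup>2) \<partial>M)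
         \<le> ennreal (c * (1 / (2 * T) * (LBINT t:{-T..T}. \<sigma> t))\<^sup>2)"
proof -
  interpret M: prob_space M by fact
  interpret pair_sigma_finite lborel M ..
  have X [measurable]: "case_prod X \<in> borel_measurable (lborel \<Otimes>\<^sub>M M)"
    using assms(2) by (simp add: measurable_process_lborel)
  \<comment> \<open>Cutting off to the interval turns set integrals into integrals over the whole
    line. Since \<sigma> is positive, s vanishes only outside the interval, where y vanishes as
    well.\<close>
  define y where "y t \<omega> = indicator {-T..T} t * (X t \<omega> - \<mu>)" for t \<omega>
  define s where "s t = indicator {-T..T} t * \<sigma> t" for t
  have int_s: "integrable lborel s"
    using \<sigma> by (simp add: set_integrable_def s_def[abs_def])
  have s_nonneg: "0 \<le> s t" for t using pos[of t] by (simp add: s_def)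
  have y_meas [measurable]: "case_prod y \<in> borel_measurable (lborel \<Otimes>\<^sub>M M)"
    unfolding y_def[abs_def] by measurable
  define I where "I = (LBINT t:{-T..T}. \<sigma> t)"
  have I: "(\<integral>\<^sup>+t. ennreal (s t) \<partial>lborel) = ennreal I"
    using int_s s_nonneg
    by (simp add: nn_integral_eq_integral I_def set_lebesgue_integral_def s_def[abs_def])
  have I_nonneg: "0 \<le> I"
    using pos by (auto simp: I_def set_lebesgue_integral_def less_imp_le intro!: integral_nonneg_AE)
  define D where "D \<omega> = (\<integral>\<^sup>+t. ennreal \<bar>y t \<omega>\<bar> \<partial>lborel)" for \<omega>
  have D_meas [measurable]: "D \<in> borel_measurable M"
    unfolding D_def[abs_def] by measurable
  have "(\<integral>\<^sup>+\<omega>. (D \<omega>)\<^sup>2 \<partial>M) \<le> ennreal c * (\<integral>\<^sup>+t. ennreal (s t) \<partial>lborel)\<^sup>2"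
    unfolding D_def
  proof (rule nn_integral_square_integral_le[OF y_meas])
    show "s \<in> borel_measurable lborel" using int_s by simp
    show "y t \<omega> = 0" if "s t = 0" for t \<omega>
      using that pos[of t] by (auto simp: s_def y_def indicator_def split: if_splits)
    show "(\<integral>\<^sup>+\<omega>. ennreal ((y t \<omega>)\<^sup>2) \<partial>M) \<le> ennreal (c * (s t)\<^sup>2)" for t
      using second[of t] by (simp add: y_def s_def indicator_def)
  qed (use s_nonneg \<open>0 \<le> c\<close> in auto)
  then have D_bound: "(\<integral>\<^sup>+\<omega>. (D \<omega>)\<^sup>2 \<partial>M) \<le> ennreal (c * I\<^sup>2)"
    using \<open>0 \<le> c\<close> I_nonneg by (simp add: I ennreal_power ennreal_mult')
  \<comment> \<open>A nonnegative function with finite integral is finite almost everywhere.\<close>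
  have "AE \<omega> in M. (D \<omega>)\<^sup>2 \<noteq> \<infinity>"
    using D_bound by (intro nn_integral_PInf_AE) (auto simp: top_unique)
  then have AE_y: "AE \<omega> in M. integrable lborel (\<lambda>t. y t \<omega>)"
  proof (rule AE_mp, intro AE_I2 impI)
    fix \<omega> assume \<omega>: "\<omega> \<in> space M" and fin: "(D \<omega>)\<^sup>2 \<noteq> \<infinity>"
    have "D \<omega> < \<infinity>"
      using fin by (auto simp: less_top power2_eq_square ennreal_mult_eq_top_iff)
    moreover have "(\<lambda>t. y t \<omega>) \<in> borel_measurable lborel"
      using measurable_compose[OF measurable_Pair2'[OF \<omega>] y_meas] by simp
    ultimately show "integrable lborel (\<lambda>t. y t \<omega>)"
      by (simp add: integrable_iff_bounded D_def)
  qed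
  have int_const: "integrable lborel (\<lambda>t. indicator {-T..T} t * \<mu>)"
    by (intro integrable_mult_left integrable_real_indicator) (auto simp: emeasure_lborel_Icc_eq)
  \<comment> \<open>Adding back the constant \<mu> on the interval, which has integral 2 T \<mu>,
    passes from the centred path to X.\<close>
  have split: "(\<lambda>t. indicator {-T..T} t *\<^sub>R X t \<omega>) = (\<lambda>t. y t \<omega> + indicator {-T..T} t * \<mu>)" for \<omega>
    by (auto simp: y_def algebra_simps)
  show "AE \<omega> in M. set_integrable lborel {-T..T} (\<lambda>t. X t \<omega>)"
    using AE_y unfolding set_integrable_def split
    by eventually_elim (intro Bochner_Integration.integrable_add int_const)
  have "AE \<omega> in M. ennreal ((temporal_mean X T \<omega> - \<mu>)\<^sup>2) \<le> ennreal ((1 / (2 * T))\<^sup>2) * (D \<omega>)\<^sup>2"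
    using AE_y
  proof eventually_elim
    fix \<omega> assume int: "integrable lborel (\<lambda>t. y t \<omega>)"
    have "(LBINT t:{-T..T}. X t \<omega>) = (LBINT t. y t \<omega>) + 2 * T * \<mu>"
      unfolding set_lebesgue_integral_def split
      using \<open>0 < T\<close> by (simp add: int int_const)
    then have err: "temporal_mean X T \<omega> - \<mu> = 1 / (2 * T) * (LBINT t. y t \<omega>)"
      using \<open>0 < T\<close> by (simp add: temporal_mean_def field_simps)
    have "ennreal \<bar>LBINT t. y t \<omega>\<bar> \<le> D \<omega>"
      using integral_norm_bound_ennreal[OF int] by (simp add: D_def)
    then have "(ennreal \<bar>LBINT t. y t \<omega>\<bar>)\<^sup>2 \<le> (D \<omega>)\<^sup>2"
      by (intro power_mono) auto
    then show "ennreal ((temporal_mean X T \<omega> - \<mu>)\<^sup>2) \<le> ennreal ((1 / (2 * T))\<^sup>2) * (D \<omega>)\<^sup>2"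
      unfolding err power_mult_distrib
      by (simp add: ennreal_mult' ennreal_power mult_left_mono)
  qed
  then have "(\<integral>\<^sup>+\<omega>. ennreal ((temporal_mean X T \<omega> - \<mu>)\<^sup>2) \<partial>M)
      \<le> (\<integral>\<^sup>+\<omega>. ennreal ((1 / (2 * T))\<^sup>2) * (D \<omega>)\<^sup>2 \<partial>M)"
    by (rule nn_integral_mono_AE)
  also have "\<dots> = ennreal ((1 / (2 * T))\<^sup>2) * (\<integral>\<^sup>+\<omega>. (D \<omega>)\<^sup>2 \<partial>M)"
    by (rule nn_integral_cmult) auto
  also have "\<dots> \<le> ennreal ((1 / (2 * T))\<^sup>2) * ennreal (c * I\<^sup>2)"
    by (intro mult_left_mono D_bound) auto
  also have "\<dots> = ennreal (c * (1 / (2 * T) * I)\<^sup>2)"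
    using \<open>0 \<le> c\<close> by (simp add: ennreal_mult[symmetric] power_divide ac_simps)
  finally show "(\<integral>\<^sup>+\<omega>. ennreal ((temporal_mean X T \<omega> - \<mu>)\<^sup>2) \<partial>M)
      \<le> ennreal (c * (1 / (2 * T) * (LBINT t:{-T..T}. \<sigma> t))\<^sup>2)"
    by (simp add: I_def)
qed

section \<open>Mean ergodicity\<close>

text \<open>The gap is the squared bias (E Z - c)^2. With c = \<mu>, a bound on the mean square
  error also bounds the variance, without computing the expectation of the temporal mean.\<close>

lemma (in prob_space) variance_le_second_moment_about:
  fixes Z :: "'a \<Rightarrow> real"
  assumes [simp]: "integrable M Z" "integrable M (\<lambda>\<omega>. (Z \<omega>)\<^sup>2)"
  shows "variance Z \<le> expectation (\<lambda>\<omega>. (Z \<omega> - c)\<^sup>2)"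
proof -
  have "expectation (\<lambda>\<omega>. (Z \<omega> - c)\<^sup>2) = variance Z + (expectation Z - c)\<^sup>2"
    unfolding variance_eq[OF assms]
    by (simp add: power2_diff prob_space)
  then show ?thesis by simp
qed

text \<open>Both the variance and the mean square error lie between 0 and \<open>B T\<close>, a
  constant times the squared time average of \<sigma>, which tends to 0.\<close>

lemma bn_process_mean_ergodic:
  assumes X: "measurable_process M X" and bn: "bn_process M X (\<lambda>_. \<mu>) \<sigma> \<alpha>"
    and van: "vanishing_time_average \<sigma>"
  shows "mean_ergodic M X \<mu>"
proof -
  interpret prob_space M using bn by (simp add: bn_process_def)
  define B where "B T = (1 + \<alpha>\<^sup>2) * (1 / (2 * T) * (LBINT t:{-T..T}. \<sigma> t))\<^sup>2" for T
  have pos: "\<And>t. 0 < \<sigma> t" using bn by (simp add: bn_process_def)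
  have \<sigma>: "set_integrable lborel {-T..T} \<sigma>" if "0 < T" for T
    using van that by (simp add: vanishing_time_average_def)
  have second: "(\<integral>\<^sup>+\<omega>. ennreal ((X t \<omega> - \<mu>)\<^sup>2) \<partial>M) \<le> ennreal ((1 + \<alpha>\<^sup>2) * (\<sigma> t)\<^sup>2)" for t
    using bn_process_second_moment[OF bn] by simp
  have c: "0 \<le> 1 + \<alpha>\<^sup>2" by simp
  note path = AE_set_integrable_path[OF prob_space_axioms X _ c pos \<sigma> second]
  note err = temporal_mean_square_error_le[OF prob_space_axioms X _ c pos \<sigma> second, folded B_def]
  have [measurable]: "temporal_mean X T \<in> borel_measurable M" for T
    by (rule borel_measurable_temporal_mean[OF X])
  \<comment> \<open>Integrability is built up from the error bound: first the squared error, then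
    the error itself since M is finite, then the temporal mean, and finally its square by
    expanding.\<close>
  have int_err: "integrable M (\<lambda>\<omega>. (temporal_mean X T \<omega> - \<mu>)\<^sup>2)" if "0 < T" for T
    using le_less_trans[OF err[OF that that] ennreal_less_top] by (intro integrableI_bounded) simp_all
  have B_nonneg: "0 \<le> B T" for T by (simp add: B_def)
  have err_le: "expectation (\<lambda>\<omega>. (temporal_mean X T \<omega> - \<mu>)\<^sup>2) \<le> B T" if "0 < T" for T
    using err[OF that that] int_err[OF that] B_nonneg by (simp add: nn_integral_eq_integral)
  have int_diff: "integrable M (\<lambda>\<omega>. temporal_mean X T \<omega> - \<mu>)" if "0 < T" for T
    by (rule square_integrable_imp_integrable[OF _ int_err[OF that]]) simp
  have int: "integrable M (temporal_mean X T)" if "0 < T" for T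
    using Bochner_Integration.integrable_add[OF int_diff[OF that] integrable_const[of \<mu>]] by simp
  have int_sq: "integrable M (\<lambda>\<omega>. (temporal_mean X T \<omega>)\<^sup>2)" if "0 < T" for T
  proof -
    have "integrable M (\<lambda>\<omega>. (temporal_mean X T \<omega> - \<mu>)\<^sup>2 + 2 * \<mu> * temporal_mean X T \<omega> - \<mu>\<^sup>2)"
      using int_err[OF that] int[OF that] by simp
    moreover have "(\<lambda>\<omega>. (temporal_mean X T \<omega> - \<mu>)\<^sup>2 + 2 * \<mu> * temporal_mean X T \<omega> - \<mu>\<^sup>2)
        = (\<lambda>\<omega>. (temporal_mean X T \<omega>)\<^sup>2)"
      by (rule ext) (simp add: power2_eq_square algebra_simps)
    ultimately show ?thesis by simp
  qed
  have "((\<lambda>T. (1 + \<alpha>\<^sup>2) * (1 / (2 * T) * (LBINT t:{-T..T}. \<sigma> t))\<^sup>2) \<longlongrightarrow> (1 + \<alpha>\<^sup>2) * 0\<^sup>2) at_top"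
    using van unfolding vanishing_time_average_def by (intro tendsto_mult tendsto_power tendsto_const) auto
  then have B: "(B \<longlongrightarrow> 0) at_top"
    by (simp add: B_def[abs_def])
  \<comment> \<open>The bounds hold for positive T only, which suffices for limits at
    infinity.\<close>
  have ev: "eventually P at_top" if "\<And>T. 0 < T \<Longrightarrow> P T" for P :: "real \<Rightarrow> bool"
    using eventually_gt_at_top[of 0] by (rule eventually_mono) (rule that)
  have "((\<lambda>T. expectation (\<lambda>\<omega>. (temporal_mean X T \<omega> - \<mu>)\<^sup>2)) \<longlongrightarrow> 0) at_top"
    by (rule tendsto_sandwich[OF _ ev tendsto_const B]) (simp_all add: err_le)
  moreover have "((\<lambda>T. variance (temporal_mean X T)) \<longlongrightarrow> 0) at_top"
  proof (rule tendsto_sandwich[OF _ ev tendsto_const B])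
    fix T :: real assume "0 < T"
    then show "variance (temporal_mean X T) \<le> B T"
      by (intro order_trans[OF variance_le_second_moment_about err_le] int int_sq)
  qed simp
  ultimately show ?thesis
    unfolding mean_ergodic_def
    by (intro conjI allI impI path bn_process_integrable[OF bn] bn_process_expectation[OF bn] int_sq)
       auto
qed

section \<open>The Gaussian example\<close>

text \<open>Integrals over the intervals never exceed the total integral, so the averages decay at
  least like 1 / T.\<close>

lemma vanishing_time_average_integrable:
  fixes \<sigma> :: "real \<Rightarrow> real"
  assumes int: "integrable lborel \<sigma>" and nonneg: "\<And>t. 0 \<le> \<sigma> t"
  shows "vanishing_time_average \<sigma>"
proof -
  have set_int: "set_integrable lborel {-T..T} \<sigma>" for T
    unfolding set_integrable_def by (rule integrable_mult_indicator[OF _ int]) simp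
  have upper: "(LBINT t:{-T..T}. \<sigma> t) \<le> integral\<^sup>L lborel \<sigma>" for T
    unfolding set_lebesgue_integral_def
    using set_int[of T] int nonneg
    by (intro integral_mono) (auto simp: set_integrable_def indicator_def)
  have lower: "0 \<le> (LBINT t:{-T..T}. \<sigma> t)" for T
    unfolding set_lebesgue_integral_def using nonneg by (intro integral_nonneg_AE) auto
  have lim: "((\<lambda>T::real. 1 / (2 * T) * integral\<^sup>L lborel \<sigma>) \<longlongrightarrow> 0) at_top"
    by (intro tendsto_mult_left_zero tendsto_divide_0[OF tendsto_const] filterlim_at_top_imp_at_infinity
        filterlim_tendsto_pos_mult_at_top[OF tendsto_const] filterlim_ident) simp
  have "((\<lambda>T. 1 / (2 * T) * (LBINT t:{-T..T}. \<sigma> t)) \<longlongrightarrow> 0) at_top"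
  proof (rule tendsto_sandwich[OF _ _ tendsto_const lim])
    show "\<forall>\<^sub>F T in at_top. 0 \<le> 1 / (2 * T) * (LBINT t:{-T..T}. \<sigma> t)"
      using eventually_gt_at_top[of 0] by eventually_elim (use lower in simp)
    show "\<forall>\<^sub>F T in at_top. 1 / (2 * T) * (LBINT t:{-T..T}. \<sigma> t) \<le> 1 / (2 * T) * integral\<^sup>L lborel \<sigma>"
      using eventually_gt_at_top[of 0] by eventually_elim (intro mult_left_mono upper, simp)
  qed
  then show ?thesis
    using set_int by (simp add: vanishing_time_average_def)
qed

text \<open>The Gaussian integral over the half line extends to the whole line by evenness.\<close>

lemma integrable_exp_minus_square: "integrable lborel (\<lambda>t::real. exp (- (t\<^sup>2)))"
  using integrable.intros[OF has_bochner_integral_even_function[OF gaussian_moment_0]] by simp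

theorem proposition8p8:
  fixes M :: "'a measure" and X :: "real \<Rightarrow> 'a \<Rightarrow> real" and \<mu> \<alpha> :: real
  shows "(\<forall>\<sigma>. measurable_process M X \<and> bn_process M X (\<lambda>_. \<mu>) \<sigma> \<alpha> \<and> vanishing_time_average \<sigma>
               \<longrightarrow> mean_ergodic M X \<mu>) \<and>
         vanishing_time_average (\<lambda>t. exp (- (t\<^sup>2))) \<and>
         (measurable_process M X \<and> bn_process M X (\<lambda>_. \<mu>) (\<lambda>t. exp (- (t\<^sup>2))) \<alpha>
               \<longrightarrow> mean_ergodic M X \<mu>)"
proof -
  have "vanishing_time_average (\<lambda>t. exp (- (t\<^sup>2)))"
    by (rule vanishing_time_average_integrable[OF integrable_exp_minus_square]) simp
  then show ?thesis
    using bn_process_mean_ergodic by blast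
qed

end
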